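(* Let $q=p^e>4$, where $p$ is a prime, and let $\ell$ be a positive integer with $2\ell\mid e$. Let $V$ be an $r$-dimensional $\mathbb F_p$-subspace of $\mathbb F_q$, let $L_V(x)=\prod_{v\in V}(x-v)$, regarded as a map $L_V:\mathbb F_q\to\mathbb F_q$, and let $t$ be an integer with $1\le t\le|\operatorname{Im}(L_V)\cap\mathbb F_{p^\ell}|$. Put $n=tp^r$ and let $s\ge1$. Then, for every integer $k$ with $s<k\le\left\lfloor\frac{p^\ell+n}{p^\ell+1}\right\rfloor$ and every integer $h$ with $0\le h\le k-s$, there exists an $[n+s,k]_q$ generalized Roth-Lempel code $C$ such that $\dim(\operatorname{Hull}_{\ell}(C))=h$.
   Context: For $q=p^e$ and $0\le\ell\le e-1$, the $\ell$-Galois inner product on $\mathbb F_q^N$ is $\langle\boldsymbol x,\boldsymbol y\rangle_\ell=\sum_i x_iy_i^{p^\ell}$. For a linear code $C\subseteq\mathbb F_q^N$, $C^{\perp_\ell}=\{\boldsymbol x\in\mathbb F_q^N:\langle\boldsymbol c,\boldsymbol x\rangle_\ell=0\ \text{for all }\boldsymbol c\in C\}$ and $\operatorname{Hull}_\ell(C)=C\cap C^{\perp_\ell}$. An $[n+s,k]_q$ generalized Roth-Lempel (GRL) code, where $1\le s\le k\le n$, is a code of the form $$\operatorname{GRL}_k(\boldsymbol a,\boldsymbol v,A_s)=\{(v_1f(a_1),\ldots,v_nf(a_n),(f_{k-s},\ldots,f_{k-1})A_s): f(x)=\textstyle\sum_{j=0}^{k-1}f_jx^j\in\mathbb F_q[x]\},$$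 where $\boldsymbol a\in\mathbb F_q^n$ has pairwise distinct entries, $\boldsymbol v\in(\mathbb F_q^* )^n$ and $A_s\in\operatorname{GL}_s(\mathbb F_q)$. *)

theory Defs
  imports
    "HOL-Algebra.Embedded_Algebras"
    "HOL-Computational_Algebra.Polynomial"
    "HOL-Computational_Algebra.Primes"
    "HOL-Library.Cardinality"
    "Jordan_Normal_Form.VS_Connect"
begin

text \<open>
  The finite field \<open>\<F>\<^sub>q\<close> is a type of class \<open>field\<close> and \<open>finite\<close> with \<open>q\<close> elements; vectors of
  length \<open>N\<close> over it are the elements of \<open>carrier_vec N\<close>, indexed from \<open>0\<close>.
\<close>

definition linear_code :: "nat \<Rightarrow> 'a::field vec set \<Rightarrow> bool" where
  "linear_code N C \<longleftrightarrow> VectorSpace.subspace class_ring C (module_vec TYPE('a) N)"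

definition code_dim :: "nat \<Rightarrow> 'a::field vec set \<Rightarrow> nat" where
  "code_dim N C = vectorspace.dim class_ring ((module_vec TYPE('a) N)\<lparr>carrier := C\<rparr>)"

text \<open>
  In the following definitions \<open>p\<close> is the characteristic of the field, passed explicitly.
\<close>

definition galois_inner :: "nat \<Rightarrow> nat \<Rightarrow> 'a::field vec \<Rightarrow> 'a vec \<Rightarrow> 'a" where
  "galois_inner p l x y = (\<Sum>i<dim_vec x. x $ i * (y $ i) ^ (p ^ l))"

definition galois_dual :: "nat \<Rightarrow> nat \<Rightarrow> nat \<Rightarrow> 'a::field vec set \<Rightarrow> 'a vec set" where
  "galois_dual p l N C = {x \<in> carrier_vec N. \<forall>c\<in>C. galois_inner p l c x = 0}"

definition galois_hull :: "nat \<Rightarrow> nat \<Rightarrow> nat \<Rightarrow> 'a::field vec set \<Rightarrow> 'a vec set" where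
  "galois_hull p l N C = C \<inter> galois_dual p l N C"

text \<open>
  The row vector \<open>(f\<^bsub>k-s\<^esub>, \<dots>, f\<^bsub>k-1\<^esub>) A\<close> is written as the transpose of \<open>A\<close> applied to a column.
\<close>

definition GRL_codeword ::
  "nat \<Rightarrow> nat \<Rightarrow> nat \<Rightarrow> 'a::field vec \<Rightarrow> 'a vec \<Rightarrow> 'a mat \<Rightarrow> 'a poly \<Rightarrow> 'a vec" where
  "GRL_codeword n s k a v A f =
     vec n (\<lambda>i. v $ i * poly f (a $ i)) @\<^sub>v
     (transpose_mat A *\<^sub>v vec s (\<lambda>j. coeff f (k - s + j)))"

text \<open>
  As \<open>k \<ge> 1\<close>, the condition \<open>degree f < k\<close> includes the zero polynomial.
\<close>

definition GRL_code ::
  "nat \<Rightarrow> nat \<Rightarrow> nat \<Rightarrow> 'a::field vec \<Rightarrow> 'a vec \<Rightarrow> 'a mat \<Rightarrow> 'a vec set" where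
  "GRL_code n s k a v A = {GRL_codeword n s k a v A f | f. degree f < k}"

definition is_GRL_code :: "nat \<Rightarrow> nat \<Rightarrow> nat \<Rightarrow> 'a::field vec set \<Rightarrow> bool" where
  "is_GRL_code n s k C \<longleftrightarrow>
     1 \<le> s \<and> s \<le> k \<and> k \<le> n \<and>
     (\<exists>a v A. a \<in> carrier_vec n \<and> inj_on (\<lambda>i. a $ i) {..<n} \<and>
              v \<in> carrier_vec n \<and> (\<forall>i<n. v $ i \<noteq> 0) \<and>
              A \<in> carrier_mat s s \<and> invertible_mat A \<and>
              C = GRL_code n s k a v A)"

definition L_map :: "'a::field set \<Rightarrow> 'a \<Rightarrow> 'a" where
  "L_map V x = (\<Prod>v\<in>V. x - v)"

end

theory Submission
  imports Defs
begin

text \<open>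
  Let \<open>Q = p ^ l\<close> and let \<open>S\<close> be the preimage under \<open>L_map V\<close> of \<open>t\<close> elements of
  \<open>\<F>\<^sub>Q\<close>. The products \<open>\<Prod>b\<in>S - {a}. a - b\<close> are \<open>\<F>\<^sub>Q\<close>-multiples of one constant, so, since the norm
  \<open>y \<mapsto> y ^ (Q + 1)\<close> reaches all of \<open>\<F>\<^sub>Q\<close> (this is where \<open>2 * l dvd e\<close> enters), Lagrange interpolation gives
  multipliers with \<open>\<Sum>a. v a ^ (Q + 1) * f a = c * coeff f (n - 1)\<close>. For \<open>degree f, degree g < k\<close>, the
  polynomial \<open>f * g ^ Q\<close> has degree at most \<open>n - 1\<close>, so the Galois form on the evaluation part only sees
  the leading coefficients. Multiplying the first \<open>m = k - s - h\<close> multipliers by some \<open>lam\<close> with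
  \<open>lam ^ (Q + 1) \<noteq> 1\<close> (available since \<open>q > 4\<close>) adds a nondegenerate diagonal form in the first \<open>m\<close>
  evaluations, and a diagonal \<open>A\<close> makes the form on the last \<open>s\<close> coordinates nondegenerate. The hull then
  consists of the polynomials of degree below \<open>k - s\<close> vanishing at \<open>m\<close> points.
\<close>

section \<open>Subfields and subspaces of the finite field\<close>

lemma subfield_closed:
  fixes K :: "'a::field set"
  assumes "subfield K (class_ring :: 'a ring)"
  shows "0 \<in> K" "1 \<in> K" "\<And>u v. u \<in> K \<Longrightarrow> v \<in> K \<Longrightarrow> u - v \<in> K" "\<And>u v. u \<in> K \<Longrightarrow> v \<in> K \<Longrightarrow> u * v \<in> K"
    "\<And>u. u \<in> K \<Longrightarrow> u \<noteq> 0 \<Longrightarrow> inverse u \<in> K"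
proof -
  have R: "ring (class_ring :: 'a ring)"
    by (intro cring.axioms(1) domain.axioms(1) field.axioms(1) class_field)
  note E = subringE[OF subfieldE(1)[OF assms], unfolded class_ring_simps]
  show "0 \<in> K" "1 \<in> K" "\<And>u v. u \<in> K \<Longrightarrow> v \<in> K \<Longrightarrow> u * v \<in> K"
    by (fact E)+
  show "u - v \<in> K" if "u \<in> K" "v \<in> K" for u v
    using E(7)[OF that(1) E(5)[OF that(2)]] by simp
  show "inverse u \<in> K" if "u \<in> K" "u \<noteq> 0" for u
    using ring.subfield_m_inv(1)[OF R assms, of u] that by (simp add: class_ring_simps)
qed

text \<open>\<open>dimension\<close> is inductive: each step adjoins a vector \<open>v\<close>
  outside the current space \<open>E\<close>. The pairs \<open>(c, w)\<close> parametrise the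
  extension uniquely, since otherwise \<open>v\<close> would lie in \<open>E\<close>, so each step
  multiplies the cardinality by \<open>card K\<close>.\<close>

lemma subspace_closed_card:
  fixes K V :: "'a::{field,finite} set"
  assumes K: "subfield K (class_ring :: 'a ring)"
    and dim: "ring.dimension (class_ring :: 'a ring) r K V"
  shows "0 \<in> V" "\<And>u v. u \<in> V \<Longrightarrow> v \<in> V \<Longrightarrow> u - v \<in> V" "card V = card K ^ r"
proof -
  have R: "ring (class_ring :: 'a ring)"
    by (intro cring.axioms(1) domain.axioms(1) field.axioms(1) class_field)
  note K0 = subfield_closed[OF K]
  \<comment> \<open>Closure under scalars is carried through the induction because uniqueness of
    \<open>c * v + w\<close> divides by \<open>c - c'\<close> inside \<open>E\<close>.\<close>
  have "0 \<in> V \<and> (\<forall>u\<in>V. \<forall>v\<in>V. u - v \<in> V) \<and> (\<forall>c\<in>K. \<forall>v\<in>V. c * v \<in> V) \<and> card V = card K ^ r"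
    using R dim K0
  proof (induction rule: ring.dimension.induct[consumes 2])
    case (1 K)
    then show ?case by (simp add: class_ring_simps)
  next
    case (2 v E n K)
    have Kcl: "0 \<in> K" "\<And>u w. u \<in> K \<Longrightarrow> w \<in> K \<Longrightarrow> u - w \<in> K"
      "\<And>u w. u \<in> K \<Longrightarrow> w \<in> K \<Longrightarrow> u * w \<in> K"
      "\<And>u. u \<in> K \<Longrightarrow> u \<noteq> 0 \<Longrightarrow> inverse u \<in> K"
      using 2 by blast+
    have E: "0 \<in> E" "\<And>u w. u \<in> E \<Longrightarrow> w \<in> E \<Longrightarrow> u - w \<in> E"
      "\<And>c w. c \<in> K \<Longrightarrow> w \<in> E \<Longrightarrow> c * w \<in> E" "card E = card K ^ n"
      using 2 by blast+
    define g where "g = (\<lambda>(c, w). c * v + w)"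
    have W: "ring.line_extension class_ring K v E = g ` (K \<times> E)"
      by (force simp: g_def ring.line_extension_mem_iff[OF R] class_ring_simps)
    have "inj_on g (K \<times> E)"
    proof (rule inj_onI, clarify)
      fix c w c' w'
      assume *: "c \<in> K" "w \<in> E" "c' \<in> K" "w' \<in> E" "g (c, w) = g (c', w')"
      then have eq: "(c - c') * v = w' - w"
        by (simp add: g_def algebra_simps)
      have "c = c'"
      proof (rule ccontr)
        assume "c \<noteq> c'"
        then have "v = inverse (c - c') * (w' - w)"
          by (simp flip: eq)
        also have "\<dots> \<in> E"
          using * \<open>c \<noteq> c'\<close> Kcl E by simp
        finally show False using \<open>v \<notin> E\<close> by simp
      qed
      then show "c = c' \<and> w = w'" using eq by simp
    qed
    then have "card (g ` (K \<times> E)) = card K ^ Suc n"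
      using E by (simp add: card_image card_cartesian_product)
    moreover have "0 \<in> g ` (K \<times> E)"
      using Kcl(1) E(1) by (intro image_eqI[of _ _ "(0, 0)"]) (auto simp: g_def)
    moreover have "x - y \<in> g ` (K \<times> E)" if "x \<in> g ` (K \<times> E)" "y \<in> g ` (K \<times> E)" for x y
    proof -
      from that obtain c w c' w' where "x = c * v + w" "y = c' * v + w'" "c \<in> K" "c' \<in> K" "w \<in> E" "w' \<in> E"
        by (auto simp: g_def)
      then show ?thesis
        using Kcl(2) E(2) by (intro image_eqI[of _ _ "(c - c', w - w')"]) (auto simp: g_def algebra_simps)
    qed
    moreover have "d * x \<in> g ` (K \<times> E)" if "d \<in> K" "x \<in> g ` (K \<times> E)" for d x
    proof -
      from that obtain c w where "x = c * v + w" "c \<in> K" "w \<in> E"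
        by (auto simp: g_def)
      then show ?thesis
        using that(1) Kcl(3) E(3) by (intro image_eqI[of _ _ "(d * c, d * w)"]) (auto simp: g_def algebra_simps)
    qed
    ultimately show ?case
      unfolding W by blast
  qed
  then show "0 \<in> V" "\<And>u v. u \<in> V \<Longrightarrow> v \<in> V \<Longrightarrow> u - v \<in> V" "card V = card K ^ r"
    by auto
qed

section \<open>Additivity of the subspace polynomial\<close>

text \<open>Translation by \<open>v\<close> merely permutes the factors. The difference form of
  additivity is the one that turns a product over a coset of \<open>V\<close> into a difference of
  two values of \<open>L_map V\<close>.\<close>

lemma L_map_shift:
  fixes V :: "'a::field set"
  assumes fin: "finite V" and zero: "0 \<in> V" and diff: "\<And>u v. u \<in> V \<Longrightarrow> v \<in> V \<Longrightarrow> u - v \<in> V"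
  shows L_map_add_mem: "v \<in> V \<Longrightarrow> L_map V (x + v) = L_map V x"
    and L_map_diff: "L_map V x - L_map V y = L_map V (x - y)"
proof -
  have neg: "- u \<in> V" if "u \<in> V" for u
    using diff[OF zero that] by simp
  show shift: "L_map V (x + v) = L_map V x" if v: "v \<in> V" for x v
    unfolding L_map_def
    by (rule prod.reindex_bij_witness[of _ "\<lambda>u. u + v" "\<lambda>u. u - v"])
      (use v diff neg in \<open>auto, metis diff_minus_eq_add\<close>)
  \<comment> \<open>Both products are monic of the same degree, so \<open>P\<close> has degree below \<open>card V\<close>, yet vanishes on \<open>y + V\<close>.\<close>
  define P where "P = (\<Prod>v\<in>V. [:- v, 1:]) - (\<Prod>v\<in>V. [:- (y + v), 1:]) - [:L_map V y:]"
  have "P = 0"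
  proof (rule ccontr)
    assume "P \<noteq> 0"
    have lead: "lead_coeff (\<Prod>v\<in>V. [:- g v, 1:]) = 1" "degree (\<Prod>v\<in>V. [:- g v, 1:]) = card V"
      for g :: "'a \<Rightarrow> 'a"
      using lead_coeff_prod[of "\<lambda>v. [:- g v, 1:]" V]
      by (simp_all add: degree_prod_eq_sum_degree)
    \<comment> \<open>Positivity keeps the constant term \<open>L_map V y\<close> away from the
      coefficient of degree \<open>card V\<close>, where the two leading ones cancel.\<close>
    have pos: "card V > 0"
      using fin zero by (auto simp: card_gt_0_iff)
    have "degree P < card V"
    proof (rule degree_lessI)
      show "P \<noteq> 0 \<or> card V > 0" using pos by simp
      show "\<forall>i\<ge>card V. coeff P i = 0"
      proof (intro allI impI)
        fix i assume i: "i \<ge> card V"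
        have "coeff (\<Prod>v\<in>V. [:- g v, 1:]) i = (if i = card V then 1 else 0)" for g :: "'a \<Rightarrow> 'a"
          using lead[of g] i by (metis coeff_eq_0 le_neq_implies_less)
        from this[of "\<lambda>v. v"] this[of "\<lambda>v. y + v"] show "coeff P i = 0"
          using i pos by (simp add: P_def coeff_pCons split: nat.split)
      qed
    qed
    moreover have "card V \<le> card {x. poly P x = 0}"
    proof -
      have "poly P (y + v) = 0" if "v \<in> V" for v
      proof -
        have "(\<Prod>u\<in>V. v - u) = 0"
          using that fin by auto
        then show ?thesis
          using shift[OF that, of y] by (simp add: P_def poly_prod L_map_def algebra_simps)
      qed
      then have "(+) y ` V \<subseteq> {x. poly P x = 0}"
        by auto
      then have "card ((+) y ` V) \<le> card {x. poly P x = 0}"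
        by (intro card_mono poly_roots_finite \<open>P \<noteq> 0\<close>)
      then show ?thesis
        by (simp add: card_image)
    qed
    ultimately show False
      using card_poly_roots_bound[OF \<open>P \<noteq> 0\<close>] by linarith
  qed
  then have "poly P x = 0" by simp
  then show "L_map V x - L_map V y = L_map V (x - y)"
    by (simp add: P_def poly_prod L_map_def algebra_simps)
qed

section \<open>Power maps and the norm\<close>

text \<open>Multiplication by \<open>x\<close> permutes the finite set \<open>G\<close>, so the
  product of all elements equals itself times \<open>x ^ card G\<close>. It is applied to the
  nonzero elements of the whole field and of a subfield.\<close>

lemma power_card_eq_1:
  fixes G :: "'a::field set"
  assumes "finite G" "0 \<notin> G" and mult: "\<And>x y. x \<in> G \<Longrightarrow> y \<in> G \<Longrightarrow> x * y \<in> G" and x: "x \<in> G"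
  shows "x ^ card G = 1"
proof -
  have x0: "x \<noteq> 0" using assms by auto
  have img: "(*) x ` G = G"
    by (rule card_subset_eq) (use assms x0 in \<open>auto simp: card_image inj_on_def\<close>)
  have "prod id G = prod id ((*) x ` G)"
    by (simp add: img)
  also have "\<dots> = (\<Prod>y\<in>G. x * y)"
    using x0 by (subst prod.reindex) (auto simp: inj_on_def)
  also have "\<dots> = x ^ card G * prod id G"
    by (simp add: prod.distrib)
  finally show ?thesis
    using assms by (auto simp: )
qed

lemma card_power_eq_le:
  fixes c :: "'a::field"
  assumes "n > 0"
  shows "finite {x. x ^ n = c}" "card {x. x ^ n = c} \<le> n"
proof -
  define P where "P = monom 1 n - [:c:]"
  have "coeff P n = 1"
    using assms by (simp add: P_def coeff_pCons split: nat.split)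
  then have P0: "P \<noteq> 0" by auto
  have "degree P \<le> n"
    unfolding P_def by (intro degree_diff_le degree_monom_le) auto
  moreover have "{x. x ^ n = c} = {x. poly P x = 0}"
    by (auto simp: P_def poly_monom)
  ultimately show "finite {x. x ^ n = c}" "card {x. x ^ n = c} \<le> n"
    using poly_roots_finite[OF P0] card_poly_roots_bound[OF P0] by auto
qed

text \<open>
  With \<open>q - 1 = (Q - 1) * M\<close>, the map \<open>y \<mapsto> y ^ M\<close> has fibres of size at most \<open>M\<close>, hence an image of size
  at least \<open>Q - 1\<close>, inside the at most \<open>Q - 1\<close> roots of unity of order \<open>Q - 1\<close>; and \<open>Q + 1\<close> divides \<open>M\<close>.
\<close>

lemma norm_surj:
  fixes x :: "'a::{field,finite}"
  assumes Q: "Q \<ge> 2" and dvd: "(Q - 1) * (Q + 1) dvd CARD('a) - 1" and x: "x ^ (Q - 1) = 1"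
  shows "\<exists>y. y ^ (Q + 1) = x"
proof -
  obtain j where j: "CARD('a) - 1 = (Q - 1) * ((Q + 1) * j)"
    using dvd unfolding dvd_def mult.assoc by blast
  have cG: "card (UNIV - {0::'a}) = CARD('a) - 1"
    by (simp add: card_Diff_singleton)
  moreover have "card (UNIV - {0::'a}) > 0"
    by (subst card_gt_0_iff) (auto intro!: exI[of _ 1])
  ultimately have j0: "(Q + 1) * j > 0"
    using j by (metis gr0I mult_0_right)
  define M where "M = (Q + 1) * j"
  define H where "H = (\<lambda>y. y ^ M) ` (UNIV - {0::'a})"
  have one: "y ^ (CARD('a) - 1) = 1" if "y \<noteq> 0" for y :: 'a
    using power_card_eq_1[of "UNIV - {0::'a}" y] that cG by auto
  have "H \<subseteq> {z. z ^ (Q - 1) = 1}"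
    using one unfolding H_def M_def j by (auto simp: mult.commute simp flip: power_mult)
  moreover have "card {z::'a. z ^ (Q - 1) = 1} \<le> card H"
  proof -
    have "(Q - 1) * M = card (UNIV - {0::'a})"
      using cG j by (simp add: M_def)
    also have "\<dots> \<le> card (\<Union>h\<in>H. {y. y ^ M = h})"
      by (intro card_mono) (auto simp: H_def)
    also have "\<dots> \<le> (\<Sum>h\<in>H. card {y. y ^ M = h})"
      by (intro card_UN_le) simp
    also have "\<dots> \<le> (\<Sum>h\<in>H. M)"
      by (intro sum_mono card_power_eq_le) (use j0 in \<open>simp add: M_def\<close>)
    finally have "(Q - 1) * M \<le> card H * M" by simp
    then have "Q - 1 \<le> card H"
      using j0 unfolding M_def by (metis mult_le_cancel2)
    then show ?thesis
      using card_power_eq_le(2)[of "Q - 1" "1::'a"] Q by linarith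
  qed
  ultimately have "H = {z. z ^ (Q - 1) = 1}"
    by (intro card_seteq) auto
  then have "x \<in> H" using x by simp
  then obtain y where "x = y ^ M" by (auto simp: H_def)
  then have "(y ^ j) ^ (Q + 1) = x"
    unfolding M_def by (metis mult.commute power_mult)
  then show ?thesis by blast
qed

section \<open>Interpolation and the choice of multipliers\<close>

text \<open>The Lagrange interpolant \<open>P\<close> of \<open>f\<close> on \<open>S\<close> is
  \<open>f\<close> itself, by degree, and every basis polynomial \<open>B a\<close> is monic of
  degree \<open>card S - 1\<close>; comparing top coefficients gives the sum.\<close>

lemma lagrange_top_coeff:
  fixes S :: "'a::field set"
  assumes fin: "finite S" and deg: "degree f < card S"
  shows "(\<Sum>a\<in>S. poly f a / (\<Prod>b\<in>S - {a}. a - b)) = coeff f (card S - 1)"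
proof -
  define D where "D a = (\<Prod>b\<in>S - {a}. a - b)" for a
  define B where "B a = (\<Prod>b\<in>S - {a}. [:- b, 1:])" for a
  define P where "P = (\<Sum>a\<in>S. Polynomial.smult (poly f a / D a) (B a))"
  have degB: "degree (B a) = card S - 1" and leadB: "lead_coeff (B a) = 1" if "a \<in> S" for a
    using that fin lead_coeff_prod[of "\<lambda>b. [:- b, 1:]" "S - {a}"]
    by (simp_all add: B_def degree_prod_eq_sum_degree)
  have D0: "D a \<noteq> 0" if "a \<in> S" for a
    using fin by (auto simp: D_def)
  have B_at: "poly (B a) c = (if c = a then D a else 0)" if "a \<in> S" "c \<in> S" for a c
    using that fin by (auto simp: B_def D_def poly_prod)
  have "poly P c = poly f c" if "c \<in> S" for c
  proof -
    have "poly P c = (\<Sum>a\<in>S. if c = a then poly f a else 0)"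
      unfolding P_def poly_sum by (rule sum.cong) (use that B_at D0 in auto)
    then show ?thesis using that fin by simp
  qed
  then have sub: "S \<subseteq> {x. poly (P - f) x = 0}" by auto
  have "degree P \<le> card S - 1"
    unfolding P_def using degB by (intro degree_sum_le fin) (metis degree_smult_le)
  then have "degree (P - f) < card S"
    using deg degree_diff_le[of P "card S - 1" f] by linarith
  have "P - f = 0"
  proof (rule ccontr)
    assume "P - f \<noteq> 0"
    then have "card S \<le> degree (P - f)"
      using card_mono[OF poly_roots_finite sub] card_poly_roots_bound[of "P - f"] by linarith
    with \<open>degree (P - f) < card S\<close> show False by simp
  qed
  then have "coeff f (card S - 1) = coeff P (card S - 1)" by simp
  also have "\<dots> = (\<Sum>a\<in>S. poly f a / D a)"
    unfolding P_def coeff_sum by (rule sum.cong) (use degB leadB in force)+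
  finally show ?thesis by (simp add: D_def)
qed

lemma L_map_fibre:
  fixes V :: "'a::field set"
  assumes "finite V" "0 \<in> V" "\<And>u v. u \<in> V \<Longrightarrow> v \<in> V \<Longrightarrow> u - v \<in> V"
  shows "{x. L_map V x = L_map V y} = (+) y ` V"
proof (intro equalityI subsetI)
  fix x assume "x \<in> {x. L_map V x = L_map V y}"
  then have "L_map V (x - y) = 0"
    using L_map_diff[OF assms, of x y] by simp
  then have "x - y \<in> V"
    using assms(1) by (auto simp: L_map_def)
  then show "x \<in> (+) y ` V"
    by (intro image_eqI[of _ _ "x - y"]) auto
next
  fix x assume "x \<in> (+) y ` V"
  then show "x \<in> {x. L_map V x = L_map V y}"
    using L_map_add_mem[OF assms] by auto
qed

text \<open>\<open>S\<close> is a union of cosets of \<open>V\<close>, one per element of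
  \<open>T\<close>. In the product of the \<open>a - b\<close>, the coset of \<open>a\<close> gives
  the constant \<open>D\<close> and each other coset gives a difference of two elements of
  \<open>F\<close>. The factor \<open>E a\<close> in \<open>F\<close> is absorbed by a norm;
  \<open>D\<close> need not lie in \<open>F\<close> and becomes the constant
  \<open>c\<close>.\<close>

lemma preimage_multipliers:
  fixes V F T :: "'a::{field,finite} set"
  assumes V: "0 \<in> V" "\<And>u v. u \<in> V \<Longrightarrow> v \<in> V \<Longrightarrow> u - v \<in> V"
    and F: "0 \<in> F" "1 \<in> F" "\<And>u v. u \<in> F \<Longrightarrow> v \<in> F \<Longrightarrow> u - v \<in> F" "\<And>u v. u \<in> F \<Longrightarrow> v \<in> F \<Longrightarrow> u * v \<in> F"
    and Q: "card F = Q" "Q \<ge> 2" "(Q - 1) * (Q + 1) dvd CARD('a) - 1"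
    and T: "T \<subseteq> range (L_map V) \<inter> F"
  defines "S \<equiv> {x. L_map V x \<in> T}"
  shows "card S = card T * card V"
    and "\<exists>v c. (\<forall>a\<in>S. v a \<noteq> 0) \<and>
           (\<forall>f. degree f < card S \<longrightarrow> (\<Sum>a\<in>S. v a ^ (Q + 1) * poly f a) = c * coeff f (card S - 1))"
proof -
  define fib where "fib b = {x. L_map V x = b}" for b
  have fib: "\<exists>x. b = L_map V x \<and> fib b = (+) x ` V" if "b \<in> T" for b
    using that T L_map_fibre[OF _ V] by (fastforce simp: fib_def)
  have S: "S = (\<Union>b\<in>T. fib b)"
    by (auto simp: S_def fib_def)
  have "card S = (\<Sum>b\<in>T. card (fib b))"
    unfolding S by (rule card_UN_disjoint) (auto simp: fib_def)
  also have "\<dots> = (\<Sum>b\<in>T. card V)"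
    by (rule sum.cong) (use fib card_image[OF inj_on_add] in \<open>metis+\<close>)
  finally show "card S = card T * card V" by simp

  define D where "D = (\<Prod>v\<in>V - {0}. - v)"
  define E where "E a = (\<Prod>b\<in>T - {L_map V a}. L_map V a - b)" for a
  have D0: "D \<noteq> 0" by (simp add: D_def)
  have E0: "E a \<noteq> 0" for a by (simp add: E_def)
  have prod_eq: "(\<Prod>b\<in>S - {a}. a - b) = D * E a" if a: "a \<in> S" for a
  proof -
    have "(\<Prod>b\<in>S - {a}. a - b) = (\<Prod>b\<in>(\<Union>c\<in>T. fib c - {a}). a - b)"
      by (rule prod.cong) (auto simp: S)
    also have "\<dots> = (\<Prod>c\<in>T. \<Prod>b\<in>fib c - {a}. a - b)"
      by (rule prod.UNION_disjoint) (auto simp: fib_def)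
    also have "\<dots> = (\<Prod>b\<in>fib (L_map V a) - {a}. a - b) * (\<Prod>c\<in>T - {L_map V a}. \<Prod>b\<in>fib c - {a}. a - b)"
      using a by (intro prod.remove) (auto simp: S_def)
    also have "(\<Prod>b\<in>fib (L_map V a) - {a}. a - b) = D"
    proof -
      \<comment> \<open>On its own coset the factors are \<open>a - (a + v) = - v\<close>, whatever
        \<open>a\<close> is.\<close>
      have "fib (L_map V a) - {a} = (+) a ` (V - {0})"
        using L_map_fibre[OF finite V, of a] by (auto simp: fib_def[symmetric])
      then show ?thesis
        by (simp add: D_def prod.reindex)
    qed
    also have "(\<Prod>c\<in>T - {L_map V a}. \<Prod>b\<in>fib c - {a}. a - b) = E a"
      unfolding E_def
    proof (rule prod.cong)
      fix c assume c: "c \<in> T - {L_map V a}"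
      then obtain x where x: "c = L_map V x" "fib c = (+) x ` V"
        using fib by blast
      have "fib c - {a} = (+) x ` V"
        using c unfolding x(2)[symmetric] by (auto simp: fib_def)
      \<comment> \<open>Here \<open>a - (x + v) = (a - x) - v\<close>, so the product over
        \<open>v\<close> is a value of \<open>L_map V\<close>, which additivity splits.\<close>
      then have "(\<Prod>b\<in>fib c - {a}. a - b) = L_map V (a - x)"
        by (simp add: L_map_def prod.reindex diff_diff_eq)
      then show "(\<Prod>b\<in>fib c - {a}. a - b) = L_map V a - c"
        using L_map_diff[OF finite V, of a x] x by simp
    qed simp
    finally show ?thesis .
  qed
  have EF: "E a \<in> F" if a: "a \<in> S" for a
  proof -
    have "(\<Prod>b\<in>B. L_map V a - b) \<in> F" if "B \<subseteq> T" for B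
      using finite[of B] that
    proof (induction B rule: finite_induct)
      case (insert b B)
      have "L_map V a - b \<in> F"
        using insert.prems a T by (intro F(3)) (auto simp: S_def)
      then show ?case
        using insert F(4) by simp
    qed (use F in auto)
    then show ?thesis by (simp add: E_def)
  qed
  have "\<exists>y. y ^ (Q + 1) = 1 / E a" if "a \<in> S" for a
  proof (rule norm_surj[OF Q(2,3)])
    have "E a ^ card (F - {0}) = 1"
      by (rule power_card_eq_1) (use F EF[OF that] E0 in auto)
    then show "(1 / E a) ^ (Q - 1) = 1"
      using F Q by (simp add: power_one_over card_Diff_singleton)
  qed
  then obtain v where v: "v a ^ (Q + 1) = 1 / E a" if "a \<in> S" for a
    by metis
  show "\<exists>v c. (\<forall>a\<in>S. v a \<noteq> 0) \<and>
           (\<forall>f. degree f < card S \<longrightarrow> (\<Sum>a\<in>S. v a ^ (Q + 1) * poly f a) = c * coeff f (card S - 1))"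
  proof (intro exI conjI ballI allI impI)
    show "v a \<noteq> 0" if "a \<in> S" for a
      using v[OF that] E0[of a] by auto
    fix f :: "'a poly" assume f: "degree f < card S"
    have "(\<Sum>a\<in>S. v a ^ (Q + 1) * poly f a) = (\<Sum>a\<in>S. D * (poly f a / (\<Prod>b\<in>S - {a}. a - b)))"
      by (rule sum.cong) (use v prod_eq D0 in \<open>auto simp del: power_Suc\<close>)
    also have "\<dots> = D * coeff f (card S - 1)"
      by (simp only: sum_distrib_left[symmetric] lagrange_top_coeff[OF finite f])
    finally show "(\<Sum>a\<in>S. v a ^ (Q + 1) * poly f a) = D * coeff f (card S - 1)" .
  qed
qed

section \<open>Codes as linear images of polynomial spaces\<close>

text \<open>Not phrased by \<open>degree f < d\<close>, so that \<open>poly_space 0\<close> is \<open>{0}\<close> rather than empty.\<close>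

definition poly_space :: "nat \<Rightarrow> 'a::zero poly set" where
  "poly_space d = {f. \<forall>i\<ge>d. coeff f i = 0}"

lemma poly_space_iff: "f \<in> poly_space d \<longleftrightarrow> f = 0 \<or> degree f < d"
proof
  show "f = 0 \<or> degree f < d" if "f \<in> poly_space d"
    using that leading_coeff_0_iff[of f] by (metis (mono_tags) mem_Collect_eq not_le poly_space_def)
qed (auto simp: poly_space_def coeff_eq_0)

text \<open>Rank-nullity applied to the coefficient-vector parametrisation \<open>T\<close>. It is
  used twice: for the code, and for its hull, which is the image of \<open>poly_space h\<close>
  under a different injective map.\<close>

lemma linear_image_poly_space:
  fixes \<Phi> :: "'a::field poly \<Rightarrow> 'a vec"
  assumes carr: "\<And>f. \<Phi> f \<in> carrier_vec N"
    and add: "\<And>f g. \<Phi> (f + g) = \<Phi> f + \<Phi> g"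
    and smult: "\<And>c f. \<Phi> (Polynomial.smult c f) = c \<cdot>\<^sub>v \<Phi> f"
    and ker: "\<And>f. f \<in> poly_space d \<Longrightarrow> \<Phi> f = 0\<^sub>v N \<Longrightarrow> f = 0"
  shows "linear_code N (\<Phi> ` poly_space d)" "code_dim N (\<Phi> ` poly_space d) = d"
proof -
  define pol :: "'a vec \<Rightarrow> 'a poly" where "pol x = (\<Sum>i<d. monom (x $ i) i)" for x
  define T where "T = \<Phi> \<circ> pol"
  have coeff_pol: "coeff (pol x) i = (if i < d then x $ i else 0)" for x i
    by (simp add: pol_def coeff_sum)
  have pol_in: "pol x \<in> poly_space d" for x
    by (simp add: poly_space_def coeff_pol)
  have T_image: "T ` carrier_vec d = \<Phi> ` poly_space d"
  proof -
    have "f = pol (vec d (coeff f))" if "f \<in> poly_space d" for f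
      using that by (intro poly_eqI) (auto simp: coeff_pol poly_space_def)
    then have "poly_space d \<subseteq> pol ` carrier_vec d"
      by (intro subsetI image_eqI[of _ _ "vec d (coeff _)"]) auto
    moreover have "pol ` carrier_vec d \<subseteq> poly_space d"
      using pol_in by blast
    ultimately have "pol ` carrier_vec d = poly_space d" by blast
    then show ?thesis by (simp add: T_def image_comp flip: image_image)
  qed
  interpret linear_map "class_ring :: 'a ring" "module_vec TYPE('a) d" "module_vec TYPE('a) N" T
  proof (intro linear_map.intro mod_hom.intro vec_vs vec_module mod_hom_axioms.intro)
    have "pol (x + y) = pol x + pol y" if "x \<in> carrier_vec d" "y \<in> carrier_vec d" for x y
      using that by (intro poly_eqI) (simp add: coeff_pol)
    moreover have "pol (c \<cdot>\<^sub>v x) = Polynomial.smult c (pol x)" if "x \<in> carrier_vec d" for c x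
      using that by (intro poly_eqI) (simp add: coeff_pol)
    ultimately show "T \<in> module_hom class_ring (module_vec TYPE('a) d) (module_vec TYPE('a) N)"
      by (auto simp: module_hom_def T_def carr add smult module_vec_simps)
  qed
  have im: "imT = \<Phi> ` poly_space d"
    by (simp add: im_def T_image module_vec_simps)
  show "linear_code N (\<Phi> ` poly_space d)"
    using imT_is_subspace unfolding linear_code_def im .
  have "inj_on T (carrier_vec d)"
  proof (rule inj_onI)
    fix x y assume xy: "x \<in> carrier_vec d" "y \<in> carrier_vec d" "T x = T y"
    \<comment> \<open>The difference is written with the scalar \<open>- 1\<close> so that it falls
      under the two linearity assumptions on \<Phi>.\<close>
    have "\<Phi> (pol x + Polynomial.smult (- 1) (pol y)) = 0\<^sub>v N"
      unfolding add smult using xy(3) carr[of "pol y"] by (auto simp: T_def)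
    moreover have "pol x + Polynomial.smult (- 1) (pol y) \<in> poly_space d"
      using pol_in[of x] pol_in[of y] by (simp add: poly_space_def)
    ultimately have "pol x + Polynomial.smult (- 1) (pol y) = 0"
      using ker by blast
    then have "coeff (pol x) i = coeff (pol y) i" for i
      by simp
    then have "x $ i = y $ i" if "i < d" for i
      using that coeff_pol by metis
    then show "x = y" using xy by auto
  qed
  then have "vectorspace.dim class_ring (V.vs kerT) = 0"
    by (intro inj_imp_dim_ker0) (simp add: module_vec_simps)
  moreover have "V.fin_dim" "V.dim = d"
    using vec_space.fin_dim vec_space.dim_is_n by auto
  ultimately show "code_dim N (\<Phi> ` poly_space d) = d"
    using rank_nullity unfolding code_dim_def im by simp
qed

text \<open>\<open>m\<close> and \<open>n\<close> are only upper bounds: if one of them is not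
  attained, both sides vanish.\<close>

lemma coeff_mult_top:
  fixes f g :: "'a::idom poly"
  assumes "degree f \<le> m" "degree g \<le> n"
  shows "coeff (f * g) (m + n) = coeff f m * coeff g n"
proof (cases "degree f = m \<and> degree g = n")
  case True
  then show ?thesis using coeff_mult_degree_sum[of f g] by simp
next
  case False
  then have "degree f < m \<or> degree g < n" using assms by auto
  moreover have "degree (f * g) \<le> degree f + degree g" by (rule degree_mult_le)
  ultimately show ?thesis using assms by (auto simp: coeff_eq_0)
qed

lemma coeff_power_top:
  fixes g :: "'a::idom poly"
  assumes "degree g \<le> n"
  shows "coeff (g ^ m) (n * m) = coeff g n ^ m"
proof (induction m)
  case (Suc m)
  have "degree (g ^ m) \<le> n * m"
    using degree_power_le[of g m] mult_right_mono[OF assms, of m] by linarith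
  then show ?case
    using coeff_mult_top[OF assms, of "g ^ m" "n * m"] Suc by simp
qed simp

lemma sum_lessThan_add:
  fixes f :: "nat \<Rightarrow> 'a::comm_monoid_add"
  shows "(\<Sum>i<m + n. f i) = (\<Sum>i<m. f i) + (\<Sum>j<n. f (m + j))"
  by (induction n) (simp_all add: add.assoc)

lemma prod_linear_factors_dvd:
  fixes a :: "nat \<Rightarrow> 'a::field"
  assumes "inj_on a {..<m}" "\<And>i. i < m \<Longrightarrow> poly g (a i) = 0"
  shows "(\<Prod>i<m. [:- a i, 1:]) dvd g"
  using assms
proof (induction m)
  case (Suc m)
  then have "(\<Prod>i<m. [:- a i, 1:]) dvd g"
    by (auto simp: lessThan_Suc)
  then obtain q where q: "g = (\<Prod>i<m. [:- a i, 1:]) * q" ..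
  have "poly (\<Prod>i<m. [:- a i, 1:]) (a m) \<noteq> 0"
    using Suc.prems(1) by (auto simp: poly_prod lessThan_Suc inj_on_def)
  then have "poly q (a m) = 0"
    using Suc.prems(2)[of m] q by simp
  then have "[:- a m, 1:] dvd q"
    by (simp add: poly_eq_0_iff_dvd)
  then show ?case
    unfolding q prod.lessThan_Suc by (rule mult_dvd_mono[OF dvd_refl])
qed simp

section \<open>The Galois form on the code and its hull\<close>

text \<open>The linear algebra, separated from the arithmetic: points and multipliers enter the form
  through \<open>top\<close>, and the bound on \<open>(k - 1) * (Q + 1)\<close> makes
  \<open>top\<close> applicable to \<open>f * g ^ Q\<close>.\<close>

lemma GRL_code_hull_dim:
  fixes a v :: "nat \<Rightarrow> 'a::field" and c lam :: 'a and p l n s k h :: nat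
  defines "Q \<equiv> p ^ l"
  assumes a: "inj_on a {..<n}" and v: "\<And>i. i < n \<Longrightarrow> v i \<noteq> 0"
    and top: "\<And>f. degree f < n \<Longrightarrow> (\<Sum>i<n. v i ^ (Q + 1) * poly f (a i)) = c * coeff f (n - 1)"
    and p: "p > 0" and s: "1 \<le> s" "s < k" and k: "(k - 1) * (Q + 1) \<le> n - 1" and n: "n \<ge> 1"
    and h: "h \<le> k - s" and lam: "lam \<noteq> 0" "lam ^ (Q + 1) \<noteq> 1"
  shows "\<exists>C :: 'a vec set.
           is_GRL_code n s k C \<and> linear_code (n + s) C \<and> code_dim (n + s) C = k \<and>
           code_dim (n + s) (galois_hull p l (n + s) C) = h"
proof -
  define m where "m = k - s - h"
  have Q: "Q > 0" using p by (simp add: Q_def)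
  have kn: "k \<le> n"
    using k n by (cases k) auto
  have m: "m \<le> k - s" "m \<le> n" "m + h = k - s" "k - s + s = k"
    using kn h s by (auto simp: m_def)
  \<comment> \<open>\<open>f * g ^ Q\<close> reaches degree \<open>n - 1\<close> only when the
    degree bound is an equality; otherwise its coefficient there is zero, which \<open>c'\<close>
    records.\<close>
  define c' where "c' = (if (k - 1) * (Q + 1) = n - 1 then c else 0)"
  \<comment> \<open>The last diagonal weight must stay nonzero after \<open>c'\<close> is added. If
    1 fails, then \<open>c' = - 1\<close> and \<open>lam\<close> works.\<close>
  obtain \<alpha> where \<alpha>: "\<alpha> \<noteq> 0" "\<alpha> ^ (Q + 1) + c' \<noteq> 0"
  proof (cases "1 + c' = 0")
    case True
    then have "lam ^ (Q + 1) + c' \<noteq> 0"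
      using lam(2) by (metis add_right_cancel)
    then show ?thesis using that lam(1) by blast
  qed (use that[of 1] in simp)
  define w where "w i = (if i < m then lam * v i else v i)" for i
  define d where "d j = (if j = s - 1 then \<alpha> else 1)" for j
  define A where "A = mat s s (\<lambda>(i, j). if i = j then d j else 0)"
  have w0: "w i \<noteq> 0" if "i < n" for i
    using v[OF that] lam by (simp add: w_def)
  have d0: "d j \<noteq> 0" for j using \<alpha> by (simp add: d_def)
  define \<Phi> where "\<Phi> f = vec n (\<lambda>i. w i * poly f (a i)) @\<^sub>v vec s (\<lambda>j. d j * coeff f (k - s + j))" for f
  have codeword: "GRL_codeword n s k (vec n a) (vec n w) A f = \<Phi> f" for f
  proof -
    have "(\<Sum>i = 0..<s. (if i = j then d j else 0) * coeff f (k - s + i)) = d j * coeff f (k - s + j)"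
      if "j < s" for j
    proof -
      have "(\<Sum>i = 0..<s. (if i = j then d j else 0) * coeff f (k - s + i))
          = (\<Sum>i = 0..<s. if i = j then d j * coeff f (k - s + i) else 0)"
        by (rule sum.cong) auto
      then show ?thesis using that by simp
    qed
    then have "transpose_mat A *\<^sub>v vec s (\<lambda>j. coeff f (k - s + j)) = vec s (\<lambda>j. d j * coeff f (k - s + j))"
      by (intro eq_vecI) (simp_all add: A_def scalar_prod_def)
    moreover have "vec n (\<lambda>i. vec n w $ i * poly f (vec n a $ i)) = vec n (\<lambda>i. w i * poly f (a i))"
      by (intro eq_vecI) simp_all
    ultimately show ?thesis
      by (simp add: GRL_codeword_def \<Phi>_def)
  qed
  define C where "C = \<Phi> ` poly_space k"
  have C: "C = GRL_code n s k (vec n a) (vec n w) A"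
  proof -
    have "poly_space k = {f :: 'a poly. degree f < k}"
      using s by (auto simp: poly_space_iff)
    then show ?thesis by (auto simp: C_def GRL_code_def codeword)
  qed
  have "is_GRL_code n s k C"
  proof -
    have prod: "mat s s (\<lambda>(i, j). if i = j then x j else 0) * mat s s (\<lambda>(i, j). if i = j then y j else 0) = 1\<^sub>m s"
      if xy: "\<And>j. x j * y j = 1" for x y :: "nat \<Rightarrow> 'a"
    proof (rule eq_matI)
      fix i j assume "i < dim_row (1\<^sub>m s)" "j < dim_col (1\<^sub>m s)"
      then have ij: "i < s" "j < s" by auto
      have "(\<Sum>u = 0..<s. (if i = u then x u else 0) * (if u = j then y j else 0))
          = (\<Sum>u = 0..<s. if u = i then (if i = j then 1 else 0) else 0)"
        by (rule sum.cong) (auto simp: xy)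
      then show "(mat s s (\<lambda>(i, j). if i = j then x j else 0) * mat s s (\<lambda>(i, j). if i = j then y j else 0)) $$ (i, j) = 1\<^sub>m s $$ (i, j)"
        using ij by (simp add: scalar_prod_def)
    qed auto
    have "invertible_mat A"
      unfolding invertible_mat_def inverts_mat_def
      by (intro conjI exI[of _ "mat s s (\<lambda>(i, j). if i = j then 1 / d j else 0)"])
        (use d0 in \<open>auto simp: A_def prod\<close>)
    then show ?thesis
      unfolding is_GRL_code_def C using s kn a w0
      by (intro conjI exI[of _ "vec n a"] exI[of _ "vec n w"] exI[of _ A])
        (auto simp: A_def inj_on_def)
  qed

  have carr: "\<Phi> f \<in> carrier_vec (n + s)" for f
    by (simp add: \<Phi>_def)
  have \<Phi>1: "\<Phi> f $ i = w i * poly f (a i)" if "i < n" for f i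
    using that by (simp add: \<Phi>_def)
  have \<Phi>2: "\<Phi> f $ (n + j) = d j * coeff f (k - s + j)" if "j < s" for f j
    using that by (simp add: \<Phi>_def)
  have dim\<Phi>: "dim_vec (\<Phi> f) = n + s" for f
    by (simp add: \<Phi>_def)
  have add: "\<Phi> (f + g) = \<Phi> f + \<Phi> g" and smult: "\<Phi> (Polynomial.smult x f) = x \<cdot>\<^sub>v \<Phi> f" for f g x
    by (rule eq_vecI; simp add: \<Phi>_def algebra_simps)+
  have ker: "f = 0" if f: "f \<in> poly_space k" "\<Phi> f = 0\<^sub>v (n + s)" for f
  proof (rule ccontr)
    assume "f \<noteq> 0"
    have "poly f (a i) = 0" if "i < n" for i
      using \<Phi>1[OF that, of f] f(2) w0[OF that] that by simp
    then have "card (a ` {..<n}) \<le> card {x. poly f x = 0}"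
      by (intro card_mono poly_roots_finite \<open>f \<noteq> 0\<close>) auto
    then have "n \<le> degree f"
      using card_poly_roots_bound[OF \<open>f \<noteq> 0\<close>] a by (simp add: card_image)
    then show False
      using f(1) s kn \<open>f \<noteq> 0\<close> by (auto simp: poly_space_iff)
  qed
  note lin = linear_image_poly_space[OF carr add smult]

  define B where "B f g = galois_inner p l (\<Phi> f) (\<Phi> g)" for f g
  \<comment> \<open>Index \<open>s - 1\<close> belongs to the coefficient of degree
    \<open>k - 1\<close>, the only one met by \<open>top\<close>, so \<open>c'\<close> is added
    exactly there.\<close>
  define \<mu> where "\<mu> j = (if j = s - 1 then \<alpha> ^ (Q + 1) + c' else 1)" for j
  have B: "B f g = (\<Sum>i<m. (lam ^ (Q + 1) - 1) * v i ^ (Q + 1) * (poly f (a i) * poly g (a i) ^ Q))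
      + (\<Sum>j<s. \<mu> j * (coeff f (k - s + j) * coeff g (k - s + j) ^ Q))"
    if f: "f \<in> poly_space k" and g: "g \<in> poly_space k" for f g
  proof -
    let ?x = "\<lambda>i. poly f (a i) * poly g (a i) ^ Q"
    let ?y = "\<lambda>j. coeff f (k - s + j) * coeff g (k - s + j) ^ Q"
    have deg: "degree f \<le> k - 1" "degree g \<le> k - 1"
      using f g s by (auto simp: poly_space_iff)
    have "degree (g ^ Q) \<le> (k - 1) * Q"
      using degree_power_le[of g Q] mult_right_mono[OF deg(2), of Q] by linarith
    then have degh: "degree (f * g ^ Q) \<le> (k - 1) * (Q + 1)"
      using degree_mult_le[of f "g ^ Q"] deg by simp
    have coeffh: "coeff (f * g ^ Q) ((k - 1) * (Q + 1)) = coeff f (k - 1) * coeff g (k - 1) ^ Q"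
      using coeff_mult_top[OF deg(1) \<open>degree (g ^ Q) \<le> _\<close>] coeff_power_top[OF deg(2), of Q] by simp
    have "(\<Sum>i<n. v i ^ (Q + 1) * ?x i) = c * coeff (f * g ^ Q) (n - 1)"
      using top[of "f * g ^ Q"] degh k n by (simp add: poly_power)
    also have "\<dots> = c' * (coeff f (k - 1) * coeff g (k - 1) ^ Q)"
      using coeffh degh k by (auto simp: c'_def coeff_eq_0)
    finally have base: "(\<Sum>i<n. v i ^ (Q + 1) * ?x i) = c' * (coeff f (k - 1) * coeff g (k - 1) ^ Q)" .
    have "B f g = (\<Sum>i<n + s. \<Phi> f $ i * (\<Phi> g $ i) ^ Q)"
      by (simp add: B_def galois_inner_def dim\<Phi> Q_def)
    also have "\<dots> = (\<Sum>i<n. \<Phi> f $ i * (\<Phi> g $ i) ^ Q) + (\<Sum>j<s. \<Phi> f $ (n + j) * (\<Phi> g $ (n + j)) ^ Q)"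
      by (rule sum_lessThan_add)
    \<comment> \<open>Scaling by \<open>lam\<close> changes the weight at the first \<open>m\<close>
      points by \<open>(lam ^ (Q + 1) - 1) * v i ^ (Q + 1)\<close>; the unscaled weights sum up by
      \<open>top\<close>.\<close>
    also have "(\<Sum>i<n. \<Phi> f $ i * (\<Phi> g $ i) ^ Q)
        = (\<Sum>i<n. v i ^ (Q + 1) * ?x i + (if i < m then (lam ^ (Q + 1) - 1) * v i ^ (Q + 1) * ?x i else 0))"
      by (rule sum.cong) (auto simp: \<Phi>1 w_def power_mult_distrib algebra_simps)
    also have "\<dots> = c' * (coeff f (k - 1) * coeff g (k - 1) ^ Q) +
        (\<Sum>i<m. (lam ^ (Q + 1) - 1) * v i ^ (Q + 1) * ?x i)"
    proof -
      have "{..<n} \<inter> {i. i < m} = {..<m}" using m by auto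
      then show ?thesis
        unfolding sum.distrib base by (simp add: sum.If_cases)
    qed
    also have "(\<Sum>j<s. \<Phi> f $ (n + j) * (\<Phi> g $ (n + j)) ^ Q) = (\<Sum>j<s. d j ^ (Q + 1) * ?y j)"
      by (rule sum.cong) (auto simp: \<Phi>2 power_mult_distrib)
    moreover have "c' * (coeff f (k - 1) * coeff g (k - 1) ^ Q) = (\<Sum>j<s. if j = s - 1 then c' * ?y j else 0)"
      using s by simp
    moreover have "(\<Sum>j<s. if j = s - 1 then c' * ?y j else 0) + (\<Sum>j<s. d j ^ (Q + 1) * ?y j) = (\<Sum>j<s. \<mu> j * ?y j)"
      unfolding sum.distrib[symmetric]
      by (rule sum.cong) (auto simp: d_def \<mu>_def algebra_simps)
    ultimately show ?thesis by (simp add: add_ac)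
  qed

  \<comment> \<open>Polynomials of degree below \<open>k - s = m + h\<close> vanishing at the first
    \<open>m\<close> points are the multiples of \<open>Z\<close> with cofactor in
    \<open>poly_space h\<close>, which yields dimension \<open>h\<close>.\<close>
  define Z where "Z = (\<Prod>i<m. [:- a i, 1:])"
  have Z0: "Z \<noteq> 0" by (simp add: Z_def)
  have degZ: "degree Z = m" by (simp add: Z_def degree_prod_eq_sum_degree)
  have vanish: "g \<in> (*) Z ` poly_space h \<longleftrightarrow> g \<in> poly_space (k - s) \<and> (\<forall>i<m. poly g (a i) = 0)" for g
  proof safe
    fix f :: "'a poly" assume f: "f \<in> poly_space h"
    show "Z * f \<in> poly_space (k - s)"
      using f m(3) Z0 degZ degree_mult_eq[OF Z0, of f] by (cases "f = 0") (auto simp: poly_space_iff)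
    show "poly (Z * f) (a i) = 0" if "i < m" for i
      using that by (auto simp: Z_def poly_prod)
  next
    assume g: "g \<in> poly_space (k - s)" "\<forall>i<m. poly g (a i) = 0"
    have "inj_on a {..<m}"
      using a m by (auto intro: inj_on_subset)
    then have "Z dvd g"
      unfolding Z_def using g(2) by (intro prod_linear_factors_dvd) auto
    then obtain q where q: "g = Z * q" ..
    moreover have "q \<in> poly_space h"
      using g(1) m(3) Z0 degZ degree_mult_eq[OF Z0, of q] unfolding q
      by (cases "q = 0") (auto simp: poly_space_iff)
    ultimately show "g \<in> (*) Z ` poly_space h" by blast
  qed
  have hull: "\<Phi> g \<in> galois_dual p l (n + s) C \<longleftrightarrow> g \<in> (*) Z ` poly_space h" if g: "g \<in> poly_space k" for g
  proof -
    have "\<Phi> g \<in> galois_dual p l (n + s) C \<longleftrightarrow> (\<forall>f\<in>poly_space k. B f g = 0)"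
      by (auto simp: galois_dual_def C_def B_def carr)
    also have "\<dots> \<longleftrightarrow> g \<in> poly_space (k - s) \<and> (\<forall>i<m. poly g (a i) = 0)"
    proof safe
      assume orth: "\<forall>f\<in>poly_space k. B f g = 0"
      show zero: "poly g (a i) = 0" if i: "i < m" for i
      proof -
        \<comment> \<open>This test polynomial has degree \<open>m - 1 < k - s\<close>, so all
          top-coefficient terms disappear, and among the first \<open>m\<close> points it is nonzero
          only at \<open>a i\<close>. The form thus isolates \<open>poly g (a i)\<close>.\<close>
        define f where "f = (\<Prod>j\<in>{..<m} - {i}. [:- a j, 1:])"
        have "degree f < k - s"
          using i m by (simp add: f_def degree_prod_eq_sum_degree)
        then have f: "f \<in> poly_space k" "\<And>j. coeff f (k - s + j) = 0"
          by (auto simp: poly_space_iff coeff_eq_0)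
        have "inj_on a {..<m}"
          using a m by (auto intro: inj_on_subset)
        then have fa: "poly f (a j) = 0 \<longleftrightarrow> j \<noteq> i" if "j < m" for j
          using that i by (auto simp: f_def poly_prod inj_on_def)
        have "0 = B f g"
          using orth f(1) by simp
        also have "\<dots> = (\<Sum>j<m. if j = i then (lam ^ (Q + 1) - 1) * v i ^ (Q + 1) * (poly f (a i) * poly g (a i) ^ Q) else 0)"
          unfolding B[OF f(1) g] f(2)
          by (simp only: mult_zero_left mult_zero_right sum.neutral_const add_0_right, intro sum.cong) (auto simp: fa)
        also have "\<dots> = (lam ^ (Q + 1) - 1) * v i ^ (Q + 1) * (poly f (a i) * poly g (a i) ^ Q)"
          using i by simp
        finally show ?thesis
          using lam(2) v[of i] fa[OF i] i m by auto
      qed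
      show "g \<in> poly_space (k - s)"
        unfolding poly_space_def
      proof safe
        fix i assume i: "i \<ge> k - s"
        show "coeff g i = 0"
        proof (cases "i < k")
          case True
          define j where "j = i - (k - s)"
          have j: "j < s" "i = k - s + j"
            using True i s by (auto simp: j_def)
          have f: "(monom 1 i :: 'a poly) \<in> poly_space k"
            using True by (auto simp: poly_space_def)
          \<comment> \<open>As \<open>g\<close> is already known to vanish at the first
            \<open>m\<close> points, testing against a monomial leaves a single coefficient of
            \<open>g\<close> with nonzero weight.\<close>
          have "0 = B (monom 1 i) g"
            using orth f by simp
          also have "\<dots> = (\<Sum>u<s. if u = j then \<mu> j * coeff g i ^ Q else 0)"
          proof -
            have "(\<Sum>u<m. (lam ^ (Q + 1) - 1) * v u ^ (Q + 1) * (poly (monom 1 i) (a u) * poly g (a u) ^ Q)) = 0"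
              by (rule sum.neutral) (use zero Q in auto)
            then show ?thesis
              unfolding B[OF f g] by (simp only: add_0_left, intro sum.cong) (use Q in \<open>auto simp: j(2)\<close>)
          qed
          also have "\<dots> = \<mu> j * coeff g i ^ Q"
            using j by simp
          finally show ?thesis
            using \<alpha> by (auto simp: \<mu>_def split: if_splits)
        qed (use g in \<open>auto simp: poly_space_def\<close>)
      qed
    next
      fix f :: "'a poly" assume f: "f \<in> poly_space k"
        and g': "g \<in> poly_space (k - s)" "\<forall>i<m. poly g (a i) = 0"
      then show "B f g = 0"
        using B[OF f g] Q by (simp add: poly_space_def zero_power)
    qed
    finally show ?thesis using vanish by simp
  qed
  have "(*) Z ` poly_space h \<subseteq> poly_space k"
  proof
    fix g assume "g \<in> (*) Z ` poly_space h"
    then have "g \<in> poly_space (k - s)" using vanish by simp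
    then show "g \<in> poly_space k" by (auto simp: poly_space_iff)
  qed
  then have "galois_hull p l (n + s) C = \<Phi> ` ((*) Z ` poly_space h)"
    using hull unfolding galois_hull_def C_def by blast
  then have hull_eq: "galois_hull p l (n + s) C = (\<lambda>f. \<Phi> (Z * f)) ` poly_space h"
    by (simp add: image_image)
  \<comment> \<open>The hull is parametrised by cofactors of \<open>Z\<close>; this map is injective
    because \<Phi> is injective on \<open>poly_space k\<close> and \<open>Z\<close> is
    nonzero.\<close>
  have "code_dim (n + s) (galois_hull p l (n + s) C) = h"
    unfolding hull_eq
  proof (rule linear_image_poly_space(2))
    fix f assume "f \<in> poly_space h" "\<Phi> (Z * f) = 0\<^sub>v (n + s)"
    then have "Z * f = 0"
      using ker \<open>(*) Z ` poly_space h \<subseteq> poly_space k\<close> by blast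
    then show "f = 0" using Z0 by simp
  qed (simp_all add: carr add smult distrib_left)
  then show ?thesis
    using \<open>is_GRL_code n s k C\<close> lin[OF ker] unfolding C_def by blast
qed

section \<open>Arithmetic of the parameters and assembly\<close>

lemma diff_one_dvd_power_diff_one: "x - 1 dvd x ^ j - (1::nat)"
proof (cases "x = 0")
  case False
  have "int x - 1 dvd int x ^ j - 1"
    using power_diff_1_eq[of "int x" j] by simp
  then have "int (x - 1) dvd int (x ^ j - 1)"
    using False by (simp add: of_nat_diff)
  then show ?thesis by (simp only: of_nat_dvd_iff)
qed (cases j; simp)

theorem mainTheorem11:
  fixes p e l r t n s k h :: nat
    and Fp Fpl V :: "'a::{field,finite} set"
  assumes "prime p"
    and "CARD('a) = p ^ e"
    and "p ^ e > 4"
    and "l > 0"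
    and "2 * l dvd e"
    and "subfield Fp (class_ring :: 'a ring)" and "card Fp = p"
    and "subfield Fpl (class_ring :: 'a ring)" and "card Fpl = p ^ l"
    and "ring.dimension (class_ring :: 'a ring) r Fp V"
    and "1 \<le> t"
    and "t \<le> card (range (L_map V) \<inter> Fpl)"
    and "n = t * p ^ r"
    and "s \<ge> 1"
    and "s < k"
    and "k \<le> (p ^ l + n) div (p ^ l + 1)"
    and "h \<le> k - s"
  shows "\<exists>C :: 'a vec set.
           is_GRL_code n s k C \<and> linear_code (n + s) C \<and> code_dim (n + s) C = k \<and>
           code_dim (n + s) (galois_hull p l (n + s) C) = h"
proof -
  define Q where "Q = p ^ l"
  have p: "p \<ge> 2" "p > 0"
    using assms(1) prime_ge_2_nat prime_gt_0_nat by auto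
  have Q: "Q \<ge> 2"
    using p self_le_power[of p l] assms(4) by (simp add: Q_def)
  obtain j where j: "e = 2 * l * j" using assms(5) by (auto elim: dvdE)
  have j0: "j > 0"
    using assms(3) j by (cases j) auto
  \<comment> \<open>Divisibility of \<open>e\<close> by \<open>2 * l\<close> makes the field size a
    power of \<open>Q ^ 2\<close>, so \<open>Q ^ 2 - 1\<close> divides \<open>CARD('a) - 1\<close>,
    as the norm argument requires.\<close>
  have q: "p ^ e = (Q ^ 2) ^ j"
    by (simp add: j Q_def mult.commute flip: power_mult)
  have Q2: "(Q - 1) * (Q + 1) = Q ^ 2 - 1"
    by (simp add: algebra_simps power2_eq_square)
  have dvd: "(Q - 1) * (Q + 1) dvd CARD('a) - 1"
    unfolding Q2 assms(2) q by (rule diff_one_dvd_power_diff_one)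
  \<comment> \<open>There are at most \<open>Q + 1\<close> roots of unity of order dividing
    \<open>Q + 1\<close>, so this inequality leaves a nonzero \<open>lam\<close> outside them. For
    \<open>Q = 2\<close> it would fail over the field of four elements, hence the bound
    \<open>p ^ e > 4\<close>.\<close>
  have "Q + 1 < CARD('a) - 1"
  proof (cases "Q = 2")
    case True
    have "j \<noteq> 1" using assms(3) q True by auto
    then have "(2::nat) ^ 4 \<le> 2 ^ (2 * j)"
      using j0 by (intro power_increasing) auto
    then show ?thesis
      using True by (simp add: assms(2) q power_mult)
  next
    case False
    have "Q ^ 2 \<le> p ^ e"
      unfolding q using self_le_power[of "Q ^ 2" j] Q j0 by simp
    moreover have "3 * Q \<le> Q ^ 2"
      using False Q by (simp add: power2_eq_square)
    ultimately show ?thesis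
      using False Q assms(2) by linarith
  qed
  moreover have "card (UNIV - {0::'a}) = CARD('a) - 1"
    by (simp add: card_Diff_singleton)
  ultimately have "\<not> UNIV - {0} \<subseteq> {x::'a. x ^ (Q + 1) = 1}"
    using card_mono[OF card_power_eq_le(1)[of "Q + 1" "1::'a"], of "UNIV - {0}"]
      card_power_eq_le(2)[of "Q + 1" "1::'a"] by auto
  then obtain lam :: 'a where lam: "lam \<noteq> 0" "lam ^ (Q + 1) \<noteq> 1" by blast

  note V = subspace_closed_card[OF assms(6,10)]
  note F = subfield_closed[OF assms(8)]
  obtain T where T: "T \<subseteq> range (L_map V) \<inter> Fpl" "card T = t"
    using obtain_subset_with_card_n[OF assms(12)] by metis
  define S where "S = {x. L_map V x \<in> T}"
  note mult = preimage_multipliers[OF V(1,2) F(1-4) assms(9)[folded Q_def] Q dvd T(1), folded S_def]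
  have S: "card S = n"
    using mult(1) by (simp add: T(2) V(3) assms(7,13))
  obtain v c where v: "\<And>a. a \<in> S \<Longrightarrow> v a \<noteq> 0"
    "\<And>f. degree f < n \<Longrightarrow> (\<Sum>a\<in>S. v a ^ (Q + 1) * poly f a) = c * coeff f (n - 1)"
    using mult(2) unfolding S by blast
  obtain a where a: "bij_betw a {..<n} S"
    using ex_bij_betw_nat_finite[of S] S by (auto simp: atLeast0LessThan)
  have n: "n \<ge> 1"
    using assms(11,13) p by simp
  \<comment> \<open>Subtracting \<open>Q + 1\<close> from both sides turns the floor bound on
    \<open>k\<close> into the degree bound for \<open>f * g ^ Q\<close>.\<close>
  have "k * (Q + 1) \<le> Q + n"
    using mult_le_mono1[OF assms(16)[folded Q_def], of "Q + 1"] div_times_less_eq_dividend[of "Q + n" "Q + 1"]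
    by linarith
  then have k: "(k - 1) * (Q + 1) \<le> n - 1"
    using n by (cases k) auto
  show ?thesis
  proof (rule GRL_code_hull_dim[where p = p and l = l and a = a and v = "v \<circ> a" and c = c and lam = lam, folded Q_def])
    show "inj_on a {..<n}" using a by (simp add: bij_betw_def)
    show "(v \<circ> a) i \<noteq> 0" if "i < n" for i
      using v(1) bij_betwE[OF a] that by simp
    show "(\<Sum>i<n. (v \<circ> a) i ^ (Q + 1) * poly f (a i)) = c * coeff f (n - 1)" if "degree f < n" for f
      using v(2)[OF that] sum.reindex_bij_betw[OF a, of "\<lambda>a. v a ^ (Q + 1) * poly f a"] by simp
  qed (use p assms(14,15,17) k n lam in auto)
qed

end
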